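(* For every integer $t\geq 4$, every (finite, simple) graph with no dominating $K_t$-model is $3\cdot 2^{t-4}$-colourable.
   Context: A dominating $K_t$-model in a graph $G$ is a sequence $(T_1,\dots,T_t)$ of pairwise disjoint non-empty connected subgraphs of $G$ such that for all $1\le i<j\le t$, every vertex of $T_j$ has a neighbour in $T_i$. *)

theory Defs
  imports "Graph_Theory.Digraph_Component" "HOL-Library.Disjoint_Sets"
begin

text \<open>
  Finite simple graphs are the library's \<open>graph\<close>: finite, loop-free, symmetric digraphs without
  parallel arcs, an edge being a pair of opposite arcs. The library's \<open>subgraph\<close> does not force
  the smaller digraph to be symmetric, so \<open>graph (T i)\<close> is required in addition to make
  \<open>T i\<close> a subgraph in the undirected sense. The library's \<open>connected\<close> includes
  non-emptiness.
\<close>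

definition dominating_K_model ::
  "nat \<Rightarrow> ('a, 'b) pre_digraph \<Rightarrow> (nat \<Rightarrow> ('a, 'b) pre_digraph) \<Rightarrow> bool" where
  "dominating_K_model t G T \<longleftrightarrow>
     (\<forall>i\<in>{1..t}. graph (T i) \<and> subgraph (T i) G \<and> verts (T i) \<noteq> {} \<and> connected (T i)) \<and>
     disjoint_family_on (\<lambda>i. verts (T i)) {1..t} \<and>
     (\<forall>i j. 1 \<le> i \<and> i < j \<and> j \<le> t \<longrightarrow>
        (\<forall>v\<in>verts (T j). \<exists>u\<in>verts (T i). v \<rightarrow>\<^bsub>G\<^esub> u))"

definition colourable :: "nat \<Rightarrow> ('a, 'b) pre_digraph \<Rightarrow> bool" where
  "colourable k G \<longleftrightarrow>
     (\<exists>c :: 'a \<Rightarrow> nat. (\<forall>v\<in>verts G. c v < k) \<and>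
        (\<forall>u\<in>verts G. \<forall>v\<in>verts G. u \<rightarrow>\<^bsub>G\<^esub> v \<longrightarrow> c u \<noteq> c v))"

end

theory Submission
  imports Defs
begin

text \<open>
  A set without a dominating \<open>K\<^sub>4\<close>-model is 2-degenerate, hence 3-colourable. Indeed, let \<open>V\<close> be a
  minimal set of minimum degree at least 3, and let \<open>T \<subseteq> V\<close> be a largest connected set such that
  \<open>V - T\<close> contains a cycle. By maximality every cycle in \<open>V - T\<close> passes through every vertex of the
  boundary \<open>N\<close> of \<open>T\<close>. Counting edges of the forest \<open>V - T - p\<close> with \<open>p \<in> N\<close> shows that an induced
  cycle of \<open>V - T\<close> has no vertex outside \<open>N\<close>. It therefore lies in \<open>N\<close>, and \<open>T\<close> followed by a
  dominating \<open>K\<^sub>3\<close>-model on the cycle is a dominating \<open>K\<^sub>4\<close>-model.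

  For larger \<open>t\<close>, each layer of a breadth-first search is dominated by the connected union of the
  previous layers, so it has no dominating \<open>K\<^bsub>t-1\<^esub>\<close>-model; two disjoint palettes, used
  for the layers alternately, double the number of colours.
\<close>

locale adjacency =
  fixes adj :: "'a \<Rightarrow> 'a \<Rightarrow> bool"
  assumes adj_sym: "adj u v \<Longrightarrow> adj v u"
    and adj_irrefl: "\<not> adj v v"
begin

section \<open>Connected sets and dominating models\<close>

text \<open>Generation by attaching single vertices excludes the empty set and supports the later
  arguments that enlarge a connected set by one boundary vertex.\<close>

inductive conn :: "'a set \<Rightarrow> bool" where
  conn_singleton: "conn {v}"
| conn_insert: "conn T \<Longrightarrow> u \<in> T \<Longrightarrow> adj v u \<Longrightarrow> conn (insert v T)"

definition boundary :: "'a set \<Rightarrow> 'a set \<Rightarrow> 'a set" where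
  "boundary S T = {v \<in> S - T. \<exists>u\<in>T. adj v u}"

text \<open>A dominating model is encoded by peeling off its first part \<open>T\<close>: all later
  parts avoid \<open>T\<close> and are dominated by it, so they form a model inside
  \<open>boundary S T\<close>.\<close>

fun has_model :: "nat \<Rightarrow> 'a set \<Rightarrow> bool" where
  "has_model 0 S \<longleftrightarrow> True"
| "has_model (Suc k) S \<longleftrightarrow> (\<exists>T\<subseteq>S. conn T \<and> has_model k (boundary S T))"

lemma conn_nonempty: "conn T \<Longrightarrow> T \<noteq> {}"
  by (induction rule: conn.induct) auto

lemma conn_insert_boundary: "conn T \<Longrightarrow> v \<in> boundary S T \<Longrightarrow> conn (insert v T)"
  by (auto simp: boundary_def intro: conn_insert)

text \<open>Each boundary vertex has a neighbour in \<open>T\<close> itself, so the vertices can be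
  attached in any order.\<close>

lemma conn_Un_boundary:
  assumes "conn T" "finite S"
  shows "conn (T \<union> boundary S T)"
proof -
  have "X \<subseteq> boundary S T \<Longrightarrow> conn (T \<union> X)" if "finite X" for X
    using that
  proof (induction rule: finite_induct)
    case (insert v X)
    then obtain u where "u \<in> T \<union> X" "adj v u"
      by (auto simp: boundary_def)
    with insert show ?case
      using conn_insert[of "T \<union> X" u v] by simp
  qed (use assms in simp)
  moreover have "finite (boundary S T)"
    using assms by (simp add: boundary_def)
  ultimately show ?thesis by blast
qed

lemma has_model_mono: "has_model k S \<Longrightarrow> S \<subseteq> S' \<Longrightarrow> has_model k S'"
proof (induction k arbitrary: S S')
  case (Suc k)
  then obtain T where "T \<subseteq> S" "conn T" "has_model k (boundary S T)"
    by auto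
  moreover have "boundary S T \<subseteq> boundary S' T"
    using Suc.prems by (auto simp: boundary_def)
  ultimately have "T \<subseteq> S' \<and> conn T \<and> has_model k (boundary S' T)"
    using Suc.IH Suc.prems(2) by blast
  then show ?case
    by auto
qed simp

lemma has_model_1: "v \<in> S \<Longrightarrow> has_model (Suc 0) S"
  using conn_singleton by auto

lemma has_model_2:
  assumes "x \<in> S" "y \<in> S" "adj x y"
  shows "has_model (Suc (Suc 0)) S"
proof -
  have "y \<in> boundary S {x}"
    using assms adj_sym adj_irrefl by (auto simp: boundary_def)
  then have "has_model (Suc 0) (boundary S {x})"
    by (rule has_model_1)
  then show ?thesis
    using assms conn_singleton by (subst has_model.simps) blast
qed

section \<open>Degrees, cores and forests\<close>

definition deg :: "'a set \<Rightarrow> 'a \<Rightarrow> nat" where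
  "deg S v = card {u \<in> S. adj v u}"

definition min_deg_ge :: "nat \<Rightarrow> 'a set \<Rightarrow> bool" where
  "min_deg_ge d S \<longleftrightarrow> S \<noteq> {} \<and> (\<forall>v\<in>S. d \<le> deg S v)"

text \<open>A forest is encoded as a set containing no set of minimum degree 2, and an induced cycle as a
  minimal set of minimum degree 2.\<close>

definition acyclic_set :: "'a set \<Rightarrow> bool" where
  "acyclic_set S \<longleftrightarrow> (\<forall>U\<subseteq>S. \<not> min_deg_ge 2 U)"

definition minimal_deg :: "nat \<Rightarrow> 'a set \<Rightarrow> bool" where
  "minimal_deg d S \<longleftrightarrow> finite S \<and> min_deg_ge d S \<and> (\<forall>U. U \<subset> S \<longrightarrow> \<not> min_deg_ge d U)"

lemma exists_minimal_deg:
  assumes "finite S" "min_deg_ge d S"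
  obtains U where "U \<subseteq> S" "minimal_deg d U"
proof -
  have "\<exists>U\<subseteq>S. minimal_deg d U"
    using assms
  proof (induction rule: finite_psubset_induct)
    case (psubset S)
    show ?case
    proof (cases "minimal_deg d S")
      case False
      then obtain U where "U \<subset> S" "min_deg_ge d U"
        using psubset by (auto simp: minimal_deg_def)
      then show ?thesis
        using psubset.IH[of U] by blast
    qed blast
  qed
  then show ?thesis
    using that by blast
qed

lemma deg_Un: "finite A \<Longrightarrow> finite B \<Longrightarrow> A \<inter> B = {} \<Longrightarrow> deg (A \<union> B) v = deg A v + deg B v"
  unfolding deg_def by (subst card_Un_disjoint[symmetric]) (auto intro: arg_cong[where f = card])

lemma deg_mono: "finite B \<Longrightarrow> A \<subseteq> B \<Longrightarrow> deg A v \<le> deg B v"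
  unfolding deg_def by (intro card_mono) auto

lemma deg_cong: "(\<And>u. adj v u \<Longrightarrow> u \<in> A \<longleftrightarrow> u \<in> B) \<Longrightarrow> deg A v = deg B v"
  unfolding deg_def by (intro arg_cong[where f = card]) auto

lemma deg_singleton_le: "deg {p} v \<le> 1"
  unfolding deg_def by (rule order_trans[OF card_mono[of "{p}"]]) auto

lemma deg_remove: "finite S \<Longrightarrow> deg S v \<le> deg (S - {p}) v + 1"
  using deg_Un[of "S - {p}" "{p}" v] deg_singleton_le[of p v] deg_mono[of "(S - {p}) \<union> {p}" S v]
  by fastforce

lemma two_neighbours:
  assumes "2 \<le> deg S v"
  obtains x where "x \<in> S" "adj v x" "x \<noteq> w"
proof -
  have "\<not> {u \<in> S. adj v u} \<subseteq> {w}"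
    using assms card_mono[of "{w}" "{u \<in> S. adj v u}"] by (auto simp: deg_def)
  then show ?thesis
    using that by blast
qed

lemma sum_deg_swap:
  assumes "finite A" "finite B"
  shows "(\<Sum>a\<in>A. deg B a) = (\<Sum>b\<in>B. deg A b)"
proof -
  have "(\<Sum>a\<in>A. deg B a) = (\<Sum>a\<in>A. \<Sum>b\<in>B. of_bool (adj a b))"
    using assms by (simp add: deg_def Int_def)
  also have "\<dots> = (\<Sum>b\<in>B. \<Sum>a\<in>A. of_bool (adj b a))"
    using adj_sym by (subst sum.swap) (intro sum.cong refl, auto)
  also have "\<dots> = (\<Sum>b\<in>B. deg A b)"
    using assms by (simp add: deg_def Int_def)
  finally show ?thesis .
qed

text \<open>By the handshake identity this is twice the number of edges inside \<open>S\<close>;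
  edge counts are kept doubled throughout.\<close>

definition deg_sum :: "'a set \<Rightarrow> nat" where
  "deg_sum S = (\<Sum>v\<in>S. deg S v)"

lemma deg_sum_Un:
  assumes "finite A" "finite B" "A \<inter> B = {}"
  shows "deg_sum (A \<union> B) = deg_sum A + 2 * (\<Sum>a\<in>A. deg B a) + deg_sum B"
  using assms sum_deg_swap[of A B]
  by (simp add: deg_sum_def sum.union_disjoint deg_Un sum.distrib)

lemma deg_sum_remove:
  assumes "finite S" "v \<in> S"
  shows "deg_sum S = deg_sum (S - {v}) + 2 * deg S v"
proof -
  have "deg (S - {v}) v = deg S v"
    using adj_irrefl by (intro deg_cong) auto
  moreover have "deg_sum {v} = 0"
    using adj_irrefl by (simp add: deg_sum_def deg_def)
  moreover have "{v} \<union> (S - {v}) = S"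
    using assms by blast
  ultimately show ?thesis
    using deg_sum_Un[of "{v}" "S - {v}"] assms by simp
qed

text \<open>This is the bound of \<open>card F - 1\<close> edges in a non-empty forest, doubled and
  free of subtraction. A forest has a vertex of degree at most 1, and deleting it loses at most one
  edge.\<close>

lemma deg_sum_acyclic:
  assumes "finite F" "F \<noteq> {}" "acyclic_set F"
  shows "deg_sum F + 2 \<le> 2 * card F"
  using assms
proof (induction rule: finite_psubset_induct)
  case (psubset F)
  then have "\<not> min_deg_ge 2 F"
    by (simp add: acyclic_set_def)
  then obtain v where v: "v \<in> F" "deg F v < 2"
    using psubset.prems by (auto simp: min_deg_ge_def not_le)
  show ?case
  proof (cases "F - {v} = {}")
    case True
    then have "F = {v}"
      using v by blast
    then show ?thesis
      using adj_irrefl by (simp add: deg_sum_def deg_def)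
  next
    case False
    have "acyclic_set (F - {v})"
      using psubset.prems by (auto simp: acyclic_set_def)
    then have "deg_sum (F - {v}) + 2 \<le> 2 * card (F - {v})"
      using psubset.IH[of "F - {v}"] v False by blast
    moreover have "card F = card (F - {v}) + 1"
      using v psubset.hyps by (metis card.remove add.commute plus_1_eq_Suc)
    ultimately show ?thesis
      using deg_sum_remove[OF psubset.hyps v(1)] v(2) by linarith
  qed
qed

text \<open>Deleting any vertex of \<open>U\<close> leaves a forest; summing the resulting edge bounds over all vertices
  gives at most \<open>card U\<close> edges in \<open>U\<close>.\<close>

lemma minimal_deg_2:
  assumes U: "minimal_deg 2 U" and v: "v \<in> U"
  shows "deg U v = 2"
proof -
  define n where "n = card U"
  have fin: "finite U" and ge: "\<And>q. q \<in> U \<Longrightarrow> 2 \<le> deg U q"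
    using U by (auto simp: minimal_deg_def min_deg_ge_def)
  have "3 \<le> n"
  proof -
    have "deg U v \<le> card (U - {v})"
      unfolding deg_def using fin adj_irrefl by (intro card_mono) auto
    then show ?thesis
      using ge[OF v] v fin by (auto simp: n_def)
  qed
  have bound: "deg_sum U + 4 \<le> 2 * n + 2 * deg U q" if q: "q \<in> U" for q
  proof -
    have "card (U - {q}) = n - 1"
      using q fin by (simp add: n_def)
    moreover have "acyclic_set (U - {q})"
      using U q by (auto simp: acyclic_set_def minimal_deg_def)
    moreover have "U - {q} \<noteq> {}"
      using two_neighbours[OF ge[OF q], of q] by blast
    ultimately have "deg_sum (U - {q}) + 2 \<le> 2 * (n - 1)"
      using deg_sum_acyclic[of "U - {q}"] fin by simp
    then show ?thesis
      using deg_sum_remove[OF fin q] \<open>3 \<le> n\<close> by linarith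
  qed
  have "(\<Sum>q\<in>U. deg_sum U + 4) \<le> (\<Sum>q\<in>U. 2 * n + 2 * deg U q)"
    using bound by (intro sum_mono) auto
  then have "n * (deg_sum U + 4) \<le> n * (2 * n) + 2 * deg_sum U"
    by (simp add: sum.distrib sum_distrib_left n_def deg_sum_def)
  \<comment> \<open>The inequality rearranges to
    \<open>(n - 2) * deg_sum U \<le> (n - 2) * (2 * n)\<close>; in terms of \<open>m\<close> the
    factor is \<open>m + 1\<close>, which is positive and cancels.\<close>
  moreover obtain m where m: "n = m + 3"
    using \<open>3 \<le> n\<close> le_Suc_ex by (metis add.commute)
  ultimately have "(m + 1) * deg_sum U \<le> (m + 1) * (2 * n)"
    by (simp add: algebra_simps)
  then have le: "deg_sum U \<le> 2 * n"
    unfolding mult_le_cancel1 by simp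
  have "deg_sum U = deg U v + (\<Sum>q\<in>U - {v}. deg U q)"
    unfolding deg_sum_def using fin v by (rule sum.remove)
  moreover have "(\<Sum>q\<in>U - {v}. 2) \<le> (\<Sum>q\<in>U - {v}. deg U q)"
    using ge by (intro sum_mono) auto
  ultimately have "deg U v + 2 * (n - 1) \<le> 2 * n"
    using le fin v by (simp add: n_def)
  then show ?thesis
    using ge[OF v] \<open>3 \<le> n\<close> by linarith
qed

text \<open>Minimal sets are connected: if no edge left \<open>T\<close>, the vertices of
  \<open>S - T\<close> would keep their degrees, and \<open>S - T\<close> would be a smaller set of
  minimum degree \<open>d\<close>.\<close>

lemma minimal_deg_boundary_nonempty:
  assumes S: "minimal_deg d S" and "T \<subseteq> S" "T \<noteq> {}" "T \<noteq> S"
  shows "boundary S T \<noteq> {}"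
proof
  assume "boundary S T = {}"
  then have "deg (S - T) v = deg S v" if "v \<in> S - T" for v
    using that by (intro deg_cong) (auto simp: boundary_def)
  then have "min_deg_ge d (S - T)"
    using assms by (auto simp: min_deg_ge_def minimal_deg_def)
  moreover have "S - T \<subset> S"
    using assms by blast
  ultimately show False
    using S unfolding minimal_deg_def by blast
qed

text \<open>An inclusion-maximal connected set with \<open>P\<close> works, since attaching a
  boundary vertex preserves connectedness and so must destroy \<open>P\<close>.\<close>

lemma exists_largest_conn:
  assumes "finite S" "T0 \<subseteq> S" "conn T0" "P T0"
  obtains T where "T \<subseteq> S" "conn T" "P T" "\<And>v. v \<in> boundary S T \<Longrightarrow> \<not> P (insert v T)"
proof -
  define \<C> where "\<C> = {T. T \<subseteq> S \<and> conn T \<and> P T}"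
  have "finite \<C>" "\<C> \<noteq> {}"
    using assms by (auto simp: \<C>_def)
  then obtain T where T: "T \<in> \<C>" "\<And>T'. T' \<in> \<C> \<Longrightarrow> T \<subseteq> T' \<Longrightarrow> T = T'"
    using finite_has_maximal[of \<C>] by auto
  have "\<not> P (insert v T)" if "v \<in> boundary S T" for v
  proof
    assume "P (insert v T)"
    then have "insert v T \<in> \<C>"
      using T(1) that conn_insert_boundary[of T v S] by (auto simp: \<C>_def boundary_def)
    then show False
      using T(2) that by (auto simp: boundary_def)
  qed
  then show ?thesis
    using that T(1) by (auto simp: \<C>_def)
qed

section \<open>Degeneracy\<close>

text \<open>Take a largest connected \<open>T\<close> that leaves an edge in \<open>U - T\<close>.
  By maximality each such edge contains every boundary vertex, and some edge has both ends in the
  boundary; its ends complete the model.\<close>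

lemma minimal_deg_2_has_model_3:
  assumes U: "minimal_deg 2 U"
  shows "has_model 3 U"
proof -
  define P where "P T \<longleftrightarrow> (\<exists>x\<in>U - T. \<exists>y\<in>U - T. adj x y)" for T
  have fin: "finite U" and ne: "U \<noteq> {}" and ge: "\<And>q. q \<in> U \<Longrightarrow> 2 \<le> deg U q"
    using U by (auto simp: minimal_deg_def min_deg_ge_def)
  obtain z where z: "z \<in> U"
    using ne by blast
  obtain x where x: "x \<in> U" "x \<noteq> z"
    using two_neighbours[OF ge[OF z], of z] by blast
  obtain y where "y \<in> U" "adj x y" "y \<noteq> z"
    using two_neighbours[OF ge[OF x(1)], of z] by blast
  with x have "P {z}"
    by (auto simp: P_def)
  then obtain T where T: "T \<subseteq> U" "conn T" "P T" "\<And>v. v \<in> boundary U T \<Longrightarrow> \<not> P (insert v T)"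
    using exists_largest_conn[of U "{z}" P] fin z conn_singleton by blast
  have edge: "x = v \<or> y = v" if "x \<in> U - T" "y \<in> U - T" "adj x y" "v \<in> boundary U T" for x y v
    using T(4)[OF that(4)] that by (auto simp: P_def)
  obtain v where v: "v \<in> boundary U T"
    using minimal_deg_boundary_nonempty[OF U T(1) conn_nonempty[OF T(2)]] T(3)
    by (auto simp: P_def)
  obtain w where w: "w \<in> U - T" "adj v w"
    using T(3) edge[OF _ _ _ v] adj_sym unfolding P_def by metis
  have vU: "v \<in> U - T"
    using v by (auto simp: boundary_def)
  \<comment> \<open>Otherwise all neighbours of \<open>w\<close> in \<open>U\<close> lie outside
    \<open>T\<close>, and one of them other than \<open>v\<close> gives an edge of
    \<open>U - T\<close> that avoids \<open>v\<close>.\<close>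
  have "w \<in> boundary U T"
  proof (rule ccontr)
    assume nb: "w \<notin> boundary U T"
    obtain x where x: "x \<in> U" "adj w x" "x \<noteq> v"
      using two_neighbours[OF ge, of w v] w by blast
    then have "x \<in> U - T"
      using nb w by (auto simp: boundary_def)
    then show False
      using edge[OF w(1) _ x(2) v] x w adj_irrefl by blast
  qed
  then have "has_model (Suc (Suc 0)) (boundary U T)"
    using v w has_model_2 by blast
  then show ?thesis
    using T by (auto simp: numeral_3_eq_3)
qed

lemma minimal_deg_3_has_model_4:
  assumes V: "minimal_deg 3 V"
  shows "has_model 4 V"
proof -
  define P where "P T \<longleftrightarrow> \<not> acyclic_set (V - T)" for T
  have fin: "finite V" and ne: "V \<noteq> {}" and ge: "\<And>q. q \<in> V \<Longrightarrow> 3 \<le> deg V q"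
    using V by (auto simp: minimal_deg_def min_deg_ge_def)
  obtain z where z: "z \<in> V"
    using ne by blast
  have "min_deg_ge 2 (V - {z})"
  proof -
    have "2 \<le> deg (V - {z}) q" if "q \<in> V" for q
      using deg_remove[OF fin, of q z] ge[OF that] by linarith
    moreover have "2 \<le> deg V z"
      using ge[OF z] by simp
    then have "V - {z} \<noteq> {}"
      using two_neighbours[of V z z] by blast
    ultimately show ?thesis
      by (auto simp: min_deg_ge_def)
  qed
  then have "P {z}"
    by (auto simp: P_def acyclic_set_def)
  then obtain T where T: "T \<subseteq> V" "conn T" "P T" "\<And>v. v \<in> boundary V T \<Longrightarrow> \<not> P (insert v T)"
    using exists_largest_conn[of V "{z}" P] fin z conn_singleton by blast
  define N where "N = boundary V T"
  have forest: "acyclic_set (V - T - {p})" if "p \<in> N" for p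
    using T(4)[of p] that unfolding P_def N_def by (metis Diff_insert)
  obtain U where U: "U \<subseteq> V - T" "minimal_deg 2 U"
  proof -
    obtain U0 where U0: "U0 \<subseteq> V - T" "min_deg_ge 2 U0"
      using T(3) by (auto simp: P_def acyclic_set_def)
    then have "finite U0"
      using fin by (meson finite_Diff finite_subset)
    then show ?thesis
      using exists_minimal_deg[OF _ U0(2)] U0(1) that by (metis order.trans)
  qed
  have finU: "finite U"
    using U by (simp add: minimal_deg_def)
  have "V \<noteq> T"
    using U by (auto simp: minimal_deg_def min_deg_ge_def)
  then obtain p where p: "p \<in> N"
    using minimal_deg_boundary_nonempty[OF V T(1) conn_nonempty[OF T(2)]] by (auto simp: N_def)
  \<comment> \<open>If \<open>U\<close> missed a vertex \<open>p\<close> of \<open>N\<close>, it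
    would lie in the forest \<open>V - T - {p}\<close>.\<close>
  have NU: "N \<subseteq> U"
    using forest U by (auto simp: acyclic_set_def minimal_deg_def)
  have "U \<subseteq> N"
  proof (rule ccontr)
    assume "\<not> U \<subseteq> N"
    then obtain u where u: "u \<in> U" "u \<notin> N"
      by blast
    have degW: "3 \<le> deg (V - T) v" if "v \<in> V - T" "v \<notin> N" for v
    proof -
      have "deg (V - T) v = deg V v"
        using that by (intro deg_cong) (auto simp: N_def boundary_def)
      then show ?thesis
        using ge[of v] that by simp
    qed
    define R where "R = V - T - U"
    have finR: "finite R" and RU: "R \<inter> U = {}" and W: "V - T = R \<union> U"
      using fin U by (auto simp: R_def)
    \<comment> \<open>Since \<open>u\<close> has degree 2 inside \<open>U\<close> but at least 3 in
      \<open>V - T\<close>, it has a neighbour in \<open>R\<close>.\<close>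
    have "deg (V - T) u = deg R u + 2"
      using deg_Un[OF finR finU RU] minimal_deg_2[OF U(2) u(1)] W by simp
    then have "R \<noteq> {}"
      using degW[of u] u U by (auto simp: deg_def)
    have pU: "p \<in> U" and pR: "p \<notin> R"
      using p NU RU by auto
    have "acyclic_set R"
      using forest[OF p] pR W by (auto simp: acyclic_set_def)
    then have R1: "deg_sum R + 2 \<le> 2 * card R"
      using finR \<open>R \<noteq> {}\<close> by (rule deg_sum_acyclic[rotated 2])
    \<comment> \<open>As \<open>N \<subseteq> U\<close>, a vertex of \<open>R\<close> lies outside
      \<open>N\<close>, so it has degree at least 3 in \<open>V - T\<close> and loses at most one by
      the removal of \<open>p\<close>.\<close>
    have "2 \<le> deg R v + deg (U - {p}) v" if "v \<in> R" for v
      using degW[of v] that NU RU W deg_Un[OF finR finU RU, of v] deg_remove[OF finU, of v p]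
      by fastforce
    then have "(\<Sum>v\<in>R. 2) \<le> (\<Sum>v\<in>R. deg R v + deg (U - {p}) v)"
      by (intro sum_mono)
    then have R2: "2 * card R \<le> deg_sum R + (\<Sum>v\<in>R. deg (U - {p}) v)"
      by (simp add: sum.distrib deg_sum_def)
    have "deg_sum U = 2 * card U"
      using minimal_deg_2[OF U(2)] by (simp add: deg_sum_def)
    then have U1: "deg_sum (U - {p}) + 4 = 2 * card U"
      using deg_sum_remove[OF finU pU] minimal_deg_2[OF U(2) pU] by simp
    have Wp: "V - T - {p} = R \<union> (U - {p})"
      using W pR by blast
    have "deg_sum (V - T - {p}) = deg_sum R + 2 * (\<Sum>v\<in>R. deg (U - {p}) v) + deg_sum (U - {p})"
      unfolding Wp using finR finU RU by (intro deg_sum_Un) auto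
    moreover have "card (V - T - {p}) + 1 = card R + card U"
    proof -
      have "card (V - T - {p}) = card R + card (U - {p})"
        unfolding Wp using finR finU RU by (intro card_Un_disjoint) auto
      moreover have "card (U - {p}) + 1 = card U"
        using finU pU by (metis Suc_eq_plus1 card.remove)
      ultimately show ?thesis
        by simp
    qed
    moreover have "deg_sum (V - T - {p}) + 2 \<le> 2 * card (V - T - {p})"
    proof (rule deg_sum_acyclic)
      show "V - T - {p} \<noteq> {}"
        using \<open>R \<noteq> {}\<close> by (simp add: Wp)
    qed (use fin forest[OF p] in simp_all)
    \<comment> \<open>Let \<open>r = card R\<close>, let \<open>e\<close> count the edges in
      \<open>R\<close> and \<open>x\<close> those between \<open>R\<close> and
      \<open>U - {p}\<close>. The forest bound for \<open>V - T - {p}\<close> and \<open>U1\<close>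
      give \<open>e + x \<le> r\<close>, while \<open>R2\<close> gives
      \<open>2 * r \<le> 2 * e + x\<close>. Hence \<open>r \<le> e\<close>, against
      \<open>e + 1 \<le> r\<close> from \<open>R1\<close>.\<close>
    ultimately show False
      using R1 R2 U1 by linarith
  qed
  then have "has_model 3 (boundary V T)"
    using minimal_deg_2_has_model_3[OF U(2)] has_model_mono by (auto simp: N_def)
  then have "has_model (Suc 3) V"
    using T unfolding has_model.simps by blast
  then show ?thesis
    by simp
qed

section \<open>Colourings\<close>

definition proper :: "nat \<Rightarrow> 'a set \<Rightarrow> ('a \<Rightarrow> nat) \<Rightarrow> bool" where
  "proper k S f \<longleftrightarrow> (\<forall>v\<in>S. f v < k) \<and> (\<forall>u\<in>S. \<forall>v\<in>S. adj u v \<longrightarrow> f u \<noteq> f v)"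

text \<open>Greedy colouring: some vertex has degree at most 2, and after the rest is coloured one
  of the three colours is missing at its neighbours.\<close>

lemma proper_3:
  assumes "finite S" "\<not> has_model 4 S"
  shows "\<exists>f. proper 3 S f"
  using assms
proof (induction rule: finite_psubset_induct)
  case (psubset S)
  show ?case
  proof (cases "S = {}")
    case False
    have "\<not> min_deg_ge 3 S"
    proof
      assume "min_deg_ge 3 S"
      then obtain U where "U \<subseteq> S" "minimal_deg 3 U"
        using exists_minimal_deg psubset.hyps by blast
      then show False
        using minimal_deg_3_has_model_4 has_model_mono psubset.prems by blast
    qed
    then obtain v where v: "v \<in> S" "deg S v < 3"
      using False by (auto simp: min_deg_ge_def not_le)
    have "\<not> has_model 4 (S - {v})"
      using psubset.prems has_model_mono by blast
    then obtain f where f: "proper 3 (S - {v}) f"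
      using psubset.IH[of "S - {v}"] v by blast
    have "card (f ` {u \<in> S. adj v u}) < 3"
      using v psubset.hyps card_image_le[of "{u \<in> S. adj v u}" f] by (simp add: deg_def)
    then have "\<not> {..<3} \<subseteq> f ` {u \<in> S. adj v u}"
      using psubset.hyps card_mono[of "f ` {u \<in> S. adj v u}" "{..<3}"] by auto
    then obtain c where c: "c < 3" "c \<notin> f ` {u \<in> S. adj v u}"
      by blast
    have "proper 3 S (f(v := c))"
      using f c adj_sym adj_irrefl by (auto simp: proper_def)
    then show ?thesis
      by blast
  qed (simp add: proper_def)
qed

definition swap_palettes :: "nat \<Rightarrow> nat \<Rightarrow> nat" where
  "swap_palettes c i = (if i < c then i + c else i - c)"

lemma swap_palettes_less: "i < 2 * c \<Longrightarrow> swap_palettes c i < 2 * c"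
  by (auto simp: swap_palettes_def)

lemma swap_palettes_eq_iff:
  "i < 2 * c \<Longrightarrow> j < 2 * c \<Longrightarrow> swap_palettes c i = swap_palettes c j \<longleftrightarrow> i = j"
  by (auto simp: swap_palettes_def)

lemma proper_swap_palettes: "proper (2 * c) S f \<Longrightarrow> proper (2 * c) S (swap_palettes c \<circ> f)"
  by (auto simp: proper_def swap_palettes_less swap_palettes_eq_iff)

text \<open>Here \<open>B\<close> is the union of the layers explored so far; the layer next to \<open>B\<close> gets the first
  palette.\<close>

lemma proper_layers:
  assumes "finite S" "\<not> has_model (Suc k) S" "B \<subseteq> S" "B = {} \<or> conn B" "0 < c"
    and layer: "\<And>X. finite X \<Longrightarrow> \<not> has_model k X \<Longrightarrow> \<exists>f. proper c X f"
  shows "\<exists>f. proper (2 * c) (S - B) f \<and> (\<forall>v\<in>boundary S B. f v < c)"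
  using assms(1-4)
proof (induction "card (S - B)" arbitrary: S B rule: less_induct)
  case less
  show ?case
  proof (cases "boundary S B = {}")
    case empty: True
    show ?thesis
    proof (cases "S - B = {}")
      case False
      \<comment> \<open>No edge joins \<open>B\<close> to the unexplored vertices, so the search
        restarts in \<open>S - B\<close> from a new root.\<close>
      then obtain r where r: "r \<in> S - B"
        by blast
      have "card (S - B - {r}) < card (S - B)"
        using r less.prems by (intro psubset_card_mono) auto
      moreover have "\<not> has_model (Suc k) (S - B)"
        using less.prems has_model_mono by blast
      ultimately obtain f where f: "proper (2 * c) (S - B - {r}) f"
          "\<forall>v\<in>boundary (S - B) {r}. f v < c"
        using less.hyps[of "S - B" "{r}"] less.prems r conn_singleton by auto
      have "f v \<noteq> c" if "v \<in> S - B" "adj v r" for v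
        using f(2) that adj_irrefl by (fastforce simp: boundary_def)
      \<comment> \<open>The neighbours of \<open>r\<close> have colours below \<open>c\<close>, so
        \<open>r\<close> takes the first colour of the second palette; it is below
        \<open>2 * c\<close> because \<open>0 < c\<close>.\<close>
      then have "proper (2 * c) (S - B) (f(r := c))"
        using f(1) \<open>0 < c\<close> adj_irrefl adj_sym[of r] by (simp add: proper_def; metis)
      then show ?thesis
        using empty by auto
    qed (use empty in \<open>auto simp: proper_def\<close>)
  next
    case False
    define X where "X = boundary S B"
    have "conn B"
      using False less.prems by (auto simp: boundary_def)
    have X: "X \<subseteq> S - B" "X \<noteq> {}" "finite X"
      using False less.prems by (auto simp: X_def boundary_def)
    \<comment> \<open>Prefixing \<open>B\<close> to a model in its boundary \<open>X\<close> would
      give a model with one more part in \<open>S\<close>.\<close>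
    have "\<not> has_model k X"
      using less.prems \<open>conn B\<close> by (auto simp: X_def)
    then obtain g where g: "proper c X g"
      using layer X by blast
    have "card (S - (B \<union> X)) < card (S - B)"
      using X less.prems by (intro psubset_card_mono) auto
    moreover have "conn (B \<union> X)"
      unfolding X_def using \<open>conn B\<close> less.prems by (intro conn_Un_boundary) auto
    ultimately obtain f where f: "proper (2 * c) (S - (B \<union> X)) f"
        "\<forall>v\<in>boundary S (B \<union> X). f v < c"
      using less.hyps[of S "B \<union> X"] less.prems X by auto
    \<comment> \<open>The layer \<open>X\<close> uses the first palette, so the recursive colouring
      is flipped to give the layer after \<open>X\<close> the second one.\<close>
    define f' where "f' = swap_palettes c \<circ> f"
    have f': "proper (2 * c) (S - (B \<union> X)) f'" "\<And>v. v \<in> boundary S (B \<union> X) \<Longrightarrow> c \<le> f' v"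
      using proper_swap_palettes[OF f(1)] f(2) by (auto simp: f'_def swap_palettes_def)
    define h where "h v = (if v \<in> X then g v else f' v)" for v
    have cross: "h u < h v" if "u \<in> X" "v \<in> S - B - X" "adj v u" for u v
    proof -
      have "c \<le> f' v"
        using that by (intro f') (auto simp: boundary_def)
      then show ?thesis
        using that g by (fastforce simp: h_def proper_def)
    qed
    have "h u \<noteq> h v" if "u \<in> S - B" "v \<in> S - B" "adj u v" for u v
    proof (cases "u \<in> X"; cases "v \<in> X")
      assume "u \<in> X" "v \<in> X"
      then show ?thesis
        using that g by (auto simp: h_def proper_def)
    next
      assume "u \<notin> X" "v \<notin> X"
      then show ?thesis
        using that f'(1) by (auto simp: h_def proper_def)
    qed (use that cross[of u v] cross[of v u] adj_sym in force)+
    moreover have "h v < 2 * c" if "v \<in> S - B" for v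
      using that g f'(1) by (fastforce simp: h_def proper_def)
    ultimately have "proper (2 * c) (S - B) h"
      by (auto simp: proper_def)
    moreover have "\<forall>v\<in>boundary S B. h v < c"
      using g by (auto simp: h_def proper_def X_def)
    ultimately show ?thesis
      by blast
  qed
qed

lemma proper_no_model:
  assumes "finite S" "\<not> has_model (k + 4) S"
  shows "\<exists>f. proper (3 * 2 ^ k) S f"
  using assms
proof (induction k arbitrary: S)
  case 0
  then show ?case
    using proper_3 by simp
next
  case (Suc k)
  then show ?case
    using proper_layers[of S "k + 4" "{}" "3 * 2 ^ k"] by (auto simp: mult.left_commute)
qed

end

section \<open>Transfer to symmetric digraphs\<close>

context graph
begin

sublocale adjacency "\<lambda>u v. u \<rightarrow>\<^bsub>G\<^esub> v"
  using adj_not_same sym_arcs by unfold_locales (auto intro: arcs_ends_symmetric)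

lemma dominates_induce_subgraphI:
  "u \<rightarrow>\<^bsub>G\<^esub> v \<Longrightarrow> u \<in> S \<Longrightarrow> v \<in> S \<Longrightarrow> u \<rightarrow>\<^bsub>G \<restriction> S\<^esub> v"
  by (auto simp: arcs_ends_conv)

lemma graph_induce_subgraph: "S \<subseteq> verts G \<Longrightarrow> graph (G \<restriction> S)"
  using digraph.graphI digraphI_induced induced_graph_imp_symmetric induced_induce sym_arcs by blast

lemma reachable_induce_conn:
  assumes "conn T" "T \<subseteq> verts G" "x \<in> T" "y \<in> T"
  shows "x \<rightarrow>\<^sup>*\<^bsub>G \<restriction> T\<^esub> y"
  using assms
proof (induction arbitrary: x y rule: conn.induct)
  case (conn_singleton v)
  then show ?case
    by (auto intro: wf_digraph.reachable_refl[OF wellformed_induce_subgraph])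
next
  case (conn_insert T u v)
  let ?H = "G \<restriction> insert v T"
  interpret H: graph ?H
    using conn_insert.prems by (intro graph_induce_subgraph)
  \<comment> \<open>Reachability from the single vertex \<open>u\<close> suffices, by symmetry and
    transitivity.\<close>
  have "u \<rightarrow>\<^sup>*\<^bsub>?H\<^esub> w" if w: "w \<in> insert v T" for w
  proof (cases "w \<in> T")
    case True
    then have "u \<rightarrow>\<^sup>*\<^bsub>G \<restriction> T\<^esub> w"
      using conn_insert by auto
    then show ?thesis
      by (rule reachable_induce_ss) blast
  next
    case False
    then have "w = v"
      using w by simp
    then show ?thesis
      using conn_insert.hyps adj_sym by (auto intro: dominates_induce_subgraphI)
  qed
  then show ?case
    using conn_insert.prems by (meson H.symmetric_reachable' H.reachable_trans)
qed

lemma connected_induce_subgraph: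
  assumes "conn T" "T \<subseteq> verts G"
  shows "connected (G \<restriction> T)"
proof -
  interpret H: graph "G \<restriction> T"
    using assms by (intro graph_induce_subgraph)
  show ?thesis
    unfolding connected_def strongly_connected_def
    using conn_nonempty[OF assms(1)] reachable_induce_conn[OF assms] H.sym_arcs
    by (simp add: H.reachable_mk_symmetric_eq)
qed

text \<open>The first part is induced on \<open>B\<close> and the recursive model is shifted by one
  index. The containment in \<open>S\<close> strengthens the induction: it puts the later parts into
  \<open>boundary S B\<close>, so they are disjoint from \<open>B\<close> and dominated by
  it.\<close>

lemma has_model_imp_dominating_K_model:
  assumes "has_model k S" "S \<subseteq> verts G"
  shows "\<exists>T. dominating_K_model k G T \<and> (\<forall>i\<in>{1..k}. verts (T i) \<subseteq> S)"
  using assms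
proof (induction k arbitrary: S)
  case 0
  then show ?case
    by (auto simp: dominating_K_model_def disjoint_family_on_def)
next
  case (Suc k)
  then obtain B where B: "B \<subseteq> S" "conn B" "has_model k (boundary S B)"
    by auto
  have "boundary S B \<subseteq> verts G"
    using Suc.prems by (auto simp: boundary_def)
  then obtain T where T: "dominating_K_model k G T"
      "\<And>i. i \<in> {1..k} \<Longrightarrow> verts (T i) \<subseteq> boundary S B"
    using Suc.IH[OF B(3)] by blast
  define T' where "T' i = (if i = 1 then G \<restriction> B else T (i - 1))" for i
  have cases: "i = 1 \<or> i \<noteq> 1 \<and> i - 1 \<in> {1..k}" if "i \<in> {1..Suc k}" for i
    using that by auto
  have BG: "B \<subseteq> verts G"
    using B Suc.prems by blast
  have sub: "graph (T' i) \<and> subgraph (T' i) G \<and> verts (T' i) \<noteq> {} \<and> connected (T' i)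
      \<and> verts (T' i) \<subseteq> S" if i: "i \<in> {1..Suc k}" for i
  proof (cases "i = 1")
    case True
    then show ?thesis
      using B BG conn_nonempty graph_induce_subgraph connected_induce_subgraph
        subgraph_induce_subgraphI by (simp add: T'_def)
  next
    case False
    then have "i - 1 \<in> {1..k}"
      using i by auto
    then show ?thesis
      using T False by (auto simp: T'_def dominating_K_model_def boundary_def)
  qed
  have rest: "verts (T' i) \<subseteq> boundary S B" if "i \<in> {1..Suc k}" "i \<noteq> 1" for i
    using cases[OF that(1)] that(2) T(2)[of "i - 1"] by (simp add: T'_def)
  have disj: "verts (T' i) \<inter> verts (T' j) = {}" if "i \<in> {1..Suc k}" "j \<in> {1..Suc k}" "i < j" for i j
  proof (cases "i = 1")
    case True
    then show ?thesis
      using rest[of j] that by (auto simp: T'_def boundary_def)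
  next
    case False
    then have "i - 1 \<in> {1..k}" "j - 1 \<in> {1..k}" "i - 1 \<noteq> j - 1" "j \<noteq> 1"
      using that by auto
    then show ?thesis
      using T(1) False by (auto simp: T'_def dominating_K_model_def disjoint_family_on_def)
  qed
  have dom: "\<exists>u\<in>verts (T' i). v \<rightarrow>\<^bsub>G\<^esub> u"
    if "1 \<le> i" "i < j" "j \<le> Suc k" "v \<in> verts (T' j)" for i j v
  proof (cases "i = 1")
    case True
    then show ?thesis
      using rest[of j] that by (auto simp: T'_def boundary_def)
  next
    case False
    then have "1 \<le> i - 1" "i - 1 < j - 1" "j - 1 \<le> k" "j \<noteq> 1"
      using that by auto
    then show ?thesis
      using T(1) False that(4) unfolding T'_def dominating_K_model_def by simp
  qed
  have "disjoint_family_on (\<lambda>i. verts (T' i)) {1..Suc k}"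
    unfolding disjoint_family_on_def using disj by (metis inf_commute nat_neq_iff)
  then have "dominating_K_model (Suc k) G T'"
    using sub dom unfolding dominating_K_model_def by blast
  then show ?case
    using sub by blast
qed

end

theorem theorem22:
  fixes t :: nat and G :: "('a, 'b) pre_digraph"
  assumes "t \<ge> 4"
    and "graph G"
    and "\<not> (\<exists>T. dominating_K_model t G T)"
  shows "colourable (3 * 2 ^ (t - 4)) G"
proof -
  interpret graph G by fact
  have "\<not> has_model (t - 4 + 4) (verts G)"
    using assms has_model_imp_dominating_K_model[of t "verts G"] by auto
  then obtain f where "proper (3 * 2 ^ (t - 4)) (verts G) f"
    using proper_no_model[of "verts G" "t - 4"] by auto
  then show ?thesis
    by (auto simp: colourable_def proper_def)
qed

end
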